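(* Let $\mathcal{H}_1,\mathcal{H}_2,\mathcal{H}$ be finite-dimensional complex Hilbert spaces, let $\otimes_a,\otimes_b:\mathcal{H}_1\times\mathcal{H}_2\to\mathcal{H}$ be two tensor product operators, and for $j=1,2$ let $\boldsymbol{B}(\mathcal{H}_j)$ be any orthonormal basis of $\mathcal{H}_j$. Then: (1) There is a uniquely determined unitary operator $W$ on $\mathcal{H}$ such that $\otimes_b=W\circ\otimes_a$, i.e. $x\otimes_b y=W(x\otimes_a y)$ for all $(x,y)\in\mathcal{H}_1\times\mathcal{H}_2$. (2) The unitary operator $W$ of (1) is uniquely determined by satisfying $W(e\otimes_a f)=e\otimes_b f$ for all $(e,f)\in\boldsymbol{B}(\mathcal{H}_1)\times\boldsymbol{B}(\mathcal{H}_2)$. (3) If $L_1$ is any linear operator on $\mathcal{H}_1$ and $L_2$ is any linear operator on $\mathcal{H}_2$, and $W$ is the operator of (1), then $L_1\otimes_a L_2$ and $L_1\otimes_b L_2$ are unitarily equivalent via $W$: $$L_1\otimes_b L_2=W\,(L_1\otimes_a L_2)\,W^\dagger.$$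
   Context: All Hilbert spaces are complex and finite-dimensional. A tensor product operator $\otimes:\mathcal{H}_1\times\mathcal{H}_2\to\mathcal{H}$ is a bilinear map such that: (i) (maximal generality) for every Hilbert space $\mathcal{V}'$ and every bilinear map $\beta:\mathcal{H}_1\times\mathcal{H}_2\to\mathcal{V}'$ there is a unique linear map $L:\mathcal{H}\to\mathcal{V}'$ with $\beta(x,y)=L(x\otimes y)$ for all $(x,y)\in\mathcal{H}_1\times\mathcal{H}_2$; (ii) (norm preservation) if $\|x\|=\|y\|=1$ then $\|x\otimes y\|=1$. There may be many different tensor product operators with the same $\mathcal{H}_1,\mathcal{H}_2,\mathcal{H}$. For a tensor product operator $\otimes$ and linear operators $L_1$ on $\mathcal{H}_1$ and $L_2$ on $\mathcal{H}_2$, $L_1\otimes L_2$ denotes the unique linear operator on $\mathcal{H}$ satisfying $(L_1\otimes L_2)(x\otimes y)=(L_1x)\otimes(L_2y)$ for all $x\in\mathcal{H}_1$, $y\in\mathcal{H}_2$. $W^\dagger$ denotes the adjoint of $W$. *)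

theory Defs
  imports "Jordan_Normal_Form.VS_Connect" "HOL-Library.FuncSet"
begin

text \<open>
  Hilbert spaces are carrier-based vector spaces over the field \<^term>\<open>class_ring :: complex ring\<close>,
  so that one can quantify over spaces, of arbitrary dimension, inside a definition.
  The fields \<open>mult\<close> and \<open>one\<close> of the record are an artefact of the module record and carry no meaning.
  The inner product is conjugate-linear in its first argument.
  Completeness is automatic in finite dimension.
\<close>

record 'a hilbert = "(complex, 'a) module" +
  cinner :: "'a \<Rightarrow> 'a \<Rightarrow> complex"

locale fd_hilbert = vectorspace "class_ring :: complex ring" V for V :: "'a hilbert" +
  assumes fin_dim: "vectorspace.fin_dim (class_ring :: complex ring) V"
    and cinner_commute:
      "\<lbrakk>x \<in> carrier V; y \<in> carrier V\<rbrakk> \<Longrightarrow> cinner V y x = cnj (cinner V x y)"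
    and cinner_add_right:
      "\<lbrakk>x \<in> carrier V; y \<in> carrier V; z \<in> carrier V\<rbrakk>
        \<Longrightarrow> cinner V x (y \<oplus>\<^bsub>V\<^esub> z) = cinner V x y + cinner V x z"
    and cinner_smult_right:
      "\<lbrakk>x \<in> carrier V; y \<in> carrier V\<rbrakk> \<Longrightarrow> cinner V x (c \<odot>\<^bsub>V\<^esub> y) = c * cinner V x y"
    and cinner_pos:
      "\<lbrakk>x \<in> carrier V; x \<noteq> \<zero>\<^bsub>V\<^esub>\<rbrakk> \<Longrightarrow> 0 < Re (cinner V x x)"

definition hnorm :: "'a hilbert \<Rightarrow> 'a \<Rightarrow> real" where
  "hnorm V x = sqrt (Re (cinner V x x))"

definition orthonormal_basis :: "'a hilbert \<Rightarrow> 'a set \<Rightarrow> bool" where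
  "orthonormal_basis V B \<longleftrightarrow>
     vectorspace.basis (class_ring :: complex ring) V B \<and>
     (\<forall>x\<in>B. \<forall>y\<in>B. cinner V x y = (if x = y then 1 else 0))"

text \<open>
  Linear maps are extensional (\<^const>\<open>undefined\<close> outside the carrier), so that equality of
  linear maps is equality on the carrier and uniqueness statements are meaningful.
\<close>

definition lin_maps :: "'a hilbert \<Rightarrow> 'b hilbert \<Rightarrow> ('a \<Rightarrow> 'b) set" where
  "lin_maps V W = LinearCombinations.module_hom (class_ring :: complex ring) V W \<inter> extensional (carrier V)"

definition adjoint_op :: "'a hilbert \<Rightarrow> ('a \<Rightarrow> 'a) \<Rightarrow> 'a \<Rightarrow> 'a" where
  "adjoint_op V T = (THE S. S \<in> lin_maps V V \<and>
     (\<forall>x\<in>carrier V. \<forall>y\<in>carrier V. cinner V (S x) y = cinner V x (T y)))"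

definition unitary_op :: "'a hilbert \<Rightarrow> ('a \<Rightarrow> 'a) \<Rightarrow> bool" where
  "unitary_op V U \<longleftrightarrow> U \<in> lin_maps V V \<and>
     compose (carrier V) (adjoint_op V U) U = (\<lambda>x\<in>carrier V. x) \<and>
     compose (carrier V) U (adjoint_op V U) = (\<lambda>x\<in>carrier V. x)"

definition bilinear_map ::
    "'a hilbert \<Rightarrow> 'b hilbert \<Rightarrow> 'c hilbert \<Rightarrow> ('a \<Rightarrow> 'b \<Rightarrow> 'c) \<Rightarrow> bool" where
  "bilinear_map V1 V2 W \<beta> \<longleftrightarrow>
     (\<forall>y\<in>carrier V2. (\<lambda>x. \<beta> x y) \<in> LinearCombinations.module_hom (class_ring :: complex ring) V1 W) \<and>
     (\<forall>x\<in>carrier V1. (\<lambda>y. \<beta> x y) \<in> LinearCombinations.module_hom (class_ring :: complex ring) V2 W)"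

text \<open>
  In the maximal generality condition \<open>V'\<close> ranges over all finite-dimensional Hilbert spaces,
  with arbitrary operations, whose carrier is a subset of the element type \<open>'c\<close> of \<open>H\<close>
  (HOL cannot quantify over types inside a definition).
  Together with norm preservation this is no restriction: a nonzero complex
  finite-dimensional space has the cardinality of the continuum, so if \<open>'c\<close> carries any nonzero
  space then it carries an isomorphic copy of every finite-dimensional Hilbert space; and if \<open>'c\<close>
  carries only zero spaces, then \<open>H = 0\<close>, norm preservation forces \<open>H1 = 0\<close> or \<open>H2 = 0\<close>, and
  the condition holds trivially for every target space.
\<close>

definition tensor_product ::
    "'a hilbert \<Rightarrow> 'b hilbert \<Rightarrow> 'c hilbert \<Rightarrow> ('a \<Rightarrow> 'b \<Rightarrow> 'c) \<Rightarrow> bool" where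
  "tensor_product H1 H2 H t \<longleftrightarrow>
     bilinear_map H1 H2 H t \<and>
     (\<forall>V' :: 'c hilbert. fd_hilbert V' \<longrightarrow>
        (\<forall>\<beta>. bilinear_map H1 H2 V' \<beta> \<longrightarrow>
          (\<exists>!L. L \<in> lin_maps H V' \<and>
             (\<forall>x\<in>carrier H1. \<forall>y\<in>carrier H2. \<beta> x y = L (t x y))))) \<and>
     (\<forall>x\<in>carrier H1. \<forall>y\<in>carrier H2. hnorm H1 x = 1 \<and> hnorm H2 y = 1 \<longrightarrow> hnorm H (t x y) = 1)"

definition tensor_op ::
    "'a hilbert \<Rightarrow> 'b hilbert \<Rightarrow> 'c hilbert \<Rightarrow> ('a \<Rightarrow> 'b \<Rightarrow> 'c) \<Rightarrow>
     ('a \<Rightarrow> 'a) \<Rightarrow> ('b \<Rightarrow> 'b) \<Rightarrow> 'c \<Rightarrow> 'c" where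
  "tensor_op H1 H2 H t L1 L2 = (THE T. T \<in> lin_maps H H \<and>
     (\<forall>x\<in>carrier H1. \<forall>y\<in>carrier H2. T (t x y) = t (L1 x) (L2 y)))"

end

theory Submission
  imports Defs
begin

text \<open>
  Norm preservation together with bilinearity gives \<open>\<parallel>x \<otimes> y\<parallel> = \<parallel>x\<parallel> \<parallel>y\<parallel>\<close>; polarizing first
  in \<open>x\<close> and then in \<open>y\<close> yields \<open>\<langle>x \<otimes> y, x' \<otimes> y'\<rangle> = \<langle>x, x'\<rangle> \<langle>y, y'\<rangle>\<close>, which does not depend on
  the tensor product. Hence the linear map induced by \<open>x \<otimes>\<^sub>a y \<mapsto> x \<otimes>\<^sub>b y\<close> preserves inner
  products, and its inverse, the map induced in the opposite direction, is its adjoint.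
\<close>

text \<open>Conjugate-linear in the first slot, as the inner product is. Hermitian symmetry is left
  out on purpose: \<open>cinner_tensor\<close> polarizes forms in \<open>y\<close> built from two
  different vectors \<open>x\<close> and \<open>x'\<close>, and these need not be Hermitian.\<close>

definition sesquilinear :: "'a hilbert \<Rightarrow> ('a \<Rightarrow> 'a \<Rightarrow> complex) \<Rightarrow> bool" where
  "sesquilinear V s \<longleftrightarrow>
     (\<forall>x\<in>carrier V. \<forall>y\<in>carrier V. \<forall>z\<in>carrier V.
        s x (y \<oplus>\<^bsub>V\<^esub> z) = s x y + s x z \<and> s (x \<oplus>\<^bsub>V\<^esub> y) z = s x z + s y z) \<and>
     (\<forall>c. \<forall>x\<in>carrier V. \<forall>y\<in>carrier V.
        s x (c \<odot>\<^bsub>V\<^esub> y) = c * s x y \<and> s (c \<odot>\<^bsub>V\<^esub> x) y = cnj c * s x y)"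

section \<open>Geometry of a single space: inner product, polarization, adjoint\<close>

context fd_hilbert
begin

lemma add_closed: "\<lbrakk>x \<in> carrier V; y \<in> carrier V\<rbrakk> \<Longrightarrow> x \<oplus>\<^bsub>V\<^esub> y \<in> carrier V"
  by simp

lemma scale_closed: "x \<in> carrier V \<Longrightarrow> c \<odot>\<^bsub>V\<^esub> x \<in> carrier V"
  by (simp add: class_ring_simps)

lemma cinner_add_left:
  assumes "x \<in> carrier V" "y \<in> carrier V" "z \<in> carrier V"
  shows "cinner V (x \<oplus>\<^bsub>V\<^esub> y) z = cinner V x z + cinner V y z"
  using assms cinner_commute[of z] by (simp add: cinner_add_right)

lemma cinner_smult_left:
  assumes "x \<in> carrier V" "y \<in> carrier V"
  shows "cinner V (c \<odot>\<^bsub>V\<^esub> x) y = cnj c * cinner V x y"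
  using assms cinner_commute[of y] scale_closed by (simp add: cinner_smult_right)

lemma cinner_zero_right:
  assumes "x \<in> carrier V"
  shows "cinner V x \<zero>\<^bsub>V\<^esub> = 0"
  using cinner_add_right[of x "\<zero>\<^bsub>V\<^esub>" "\<zero>\<^bsub>V\<^esub>"] assms by simp

lemma cinner_self:
  assumes "x \<in> carrier V"
  shows "cinner V x x = of_real ((hnorm V x)\<^sup>2)"
proof -
  have "Im (cinner V x x) = 0"
    using arg_cong[OF cinner_commute[OF assms assms], of Im] by simp
  moreover have "0 \<le> Re (cinner V x x)"
    using cinner_pos[OF assms] cinner_zero_right[OF assms] by (cases "x = \<zero>\<^bsub>V\<^esub>") auto
  ultimately show ?thesis by (simp add: hnorm_def complex_eq_iff)
qed

lemma hnorm_pos: "\<lbrakk>x \<in> carrier V; x \<noteq> \<zero>\<^bsub>V\<^esub>\<rbrakk> \<Longrightarrow> 0 < hnorm V x"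
  using cinner_pos by (simp add: hnorm_def)

lemma hnorm_scale:
  assumes "x \<in> carrier V"
  shows "hnorm V (c \<odot>\<^bsub>V\<^esub> x) = cmod c * hnorm V x"
proof -
  have "cinner V (c \<odot>\<^bsub>V\<^esub> x) (c \<odot>\<^bsub>V\<^esub> x) = (c * cnj c) * cinner V x x"
    using assms by (simp add: cinner_smult_left cinner_smult_right scale_closed)
  also have "\<dots> = of_real ((cmod c * hnorm V x)\<^sup>2)"
    by (simp add: cinner_self[OF assms] power_mult_distrib flip: complex_norm_square)
  finally have "Re (cinner V (c \<odot>\<^bsub>V\<^esub> x) (c \<odot>\<^bsub>V\<^esub> x)) = (cmod c * hnorm V x)\<^sup>2" by simp
  moreover have "0 \<le> hnorm V x"
    using hnorm_pos[OF assms] cinner_zero_right[OF assms]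
    by (cases "x = \<zero>\<^bsub>V\<^esub>") (auto simp: hnorm_def)
  ultimately show ?thesis by (simp add: hnorm_def[of V "c \<odot>\<^bsub>V\<^esub> x"])
qed

text \<open>Nondegeneracy: testing against the difference \<open>d\<close> itself gives
  \<open>cinner V d d = 0\<close>, which positivity allows only for the zero vector.\<close>

lemma cinner_right_cancel:
  assumes "x \<in> carrier V" "x' \<in> carrier V"
    and eq: "\<And>y. y \<in> carrier V \<Longrightarrow> cinner V x y = cinner V x' y"
  shows "x = x'"
proof -
  define d where "d = x \<oplus>\<^bsub>V\<^esub> (-1) \<odot>\<^bsub>V\<^esub> x'"
  have d: "d \<in> carrier V"
    using assms by (simp add: d_def scale_closed)
  have minus: "(-1) \<odot>\<^bsub>V\<^esub> x' = \<ominus>\<^bsub>V\<^esub> x'"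
    using smult_minus_1[OF assms(2)] by (simp add: class_ring_simps)
  have "cinner V d d = 0"
    using assms(1,2) eq[OF d] d
    \<comment> \<open>Only the left argument is expanded; the right one stays \<open>d\<close>, so
      that the hypothesis at the test vector \<open>d\<close> cancels the two summands.\<close>
    by (subst (1) d_def) (simp add: cinner_add_left cinner_smult_left scale_closed)
  then have "d = \<zero>\<^bsub>V\<^esub>"
    using cinner_pos[OF d] by force
  then show ?thesis
    using assms(1,2) minus by (simp add: d_def flip: a_minus_def)
qed

text \<open>The difference of the two forms has zero diagonal. Expanding it at \<open>x + z\<close>
  leaves only the mixed terms, and the choices \<open>z = y\<close> and \<open>z = \<i> y\<close>
  give two independent equations for them.\<close>

lemma sesquilinear_polarization:
  assumes s: "sesquilinear V s" and t: "sesquilinear V t"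
    and diag: "\<And>x. x \<in> carrier V \<Longrightarrow> s x x = t x x"
    and xy: "x \<in> carrier V" "y \<in> carrier V"
  shows "s x y = t x y"
proof -
  define d where "d x y = s x y - t x y" for x y
  have d: "sesquilinear V d"
    using s t unfolding sesquilinear_def d_def by (auto simp: algebra_simps)
  have d0: "d z z = 0" if "z \<in> carrier V" for z
    using diag[OF that] by (simp add: d_def)
  have iy: "\<i> \<odot>\<^bsub>V\<^esub> y \<in> carrier V"
    using xy scale_closed by blast
  have "d (x \<oplus>\<^bsub>V\<^esub> z) (x \<oplus>\<^bsub>V\<^esub> z) = d x x + d x z + d z x + d z z" if "z \<in> carrier V" for z
    using d that xy add_closed unfolding sesquilinear_def by simp
  then have sum0: "d x z + d z x = 0" if "z \<in> carrier V" for z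
    using that xy d0 by simp
  have "d x y + d y x = 0"
    using sum0 xy by blast
  \<comment> \<open>Conjugate-linearity turns the factor \<i> into -\<i> in the first slot, so this
    relation has the opposite sign from the previous one; together they force
    \<open>d x y = 0\<close>.\<close>
  moreover have "\<i> * d x y - \<i> * d y x = 0"
    using sum0[OF iy] d xy unfolding sesquilinear_def by simp
  ultimately have "d x y = 0"
    by (simp add: algebra_simps)
  then show ?thesis by (simp add: d_def)
qed

lemma sesquilinear_scaled_cinner: "sesquilinear V (\<lambda>x y. c * cinner V x y)"
  unfolding sesquilinear_def
  by (auto simp: cinner_add_right cinner_add_left cinner_smult_right cinner_smult_left algebra_simps)

lemma sesquilinear_cinner_hom:
  assumes "f \<in> LinearCombinations.module_hom (class_ring :: complex ring) U V"
    and "g \<in> LinearCombinations.module_hom (class_ring :: complex ring) U V"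
  shows "sesquilinear U (\<lambda>x y. cinner V (f x) (g y))"
  using assms unfolding sesquilinear_def LinearCombinations.module_hom_def
  by (auto simp: Pi_iff class_ring_simps cinner_add_right cinner_add_left
      cinner_smult_right cinner_smult_left)

lemma module_hom_eq_on_basis:
  assumes "fd_hilbert U" and B: "basis B"
    and f: "f \<in> LinearCombinations.module_hom (class_ring :: complex ring) V U"
    and g: "g \<in> LinearCombinations.module_hom (class_ring :: complex ring) V U"
    and eq: "\<And>e. e \<in> B \<Longrightarrow> f e = g e"
    and x: "x \<in> carrier V"
  shows "f x = g x"
proof -
  interpret U: fd_hilbert U by fact
  interpret f: mod_hom class_ring V U f by unfold_locales fact
  interpret g: mod_hom class_ring V U g by unfold_locales fact
  \<comment> \<open>The equalizer of two linear maps is a submodule; once it contains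
    \<open>B\<close>, it contains the span of \<open>B\<close>.\<close>
  let ?E = "{x \<in> carrier V. f x = g x}"
  have "submodule class_ring ?E V"
    by unfold_locales auto
  moreover have "B \<subseteq> ?E"
    using B eq by (auto simp: basis_def)
  ultimately have "span B \<subseteq> ?E"
    by (intro span_is_subset)
  then show ?thesis
    using x B by (auto simp: basis_def)
qed

text \<open>Makes the definite description usable: the candidate \<open>S\<close> gives existence,
  and uniqueness comes from nondegeneracy on the carrier and extensionality off it.\<close>

lemma adjoint_op_eqI:
  assumes S: "S \<in> lin_maps V V"
    and adj: "\<And>x y. \<lbrakk>x \<in> carrier V; y \<in> carrier V\<rbrakk> \<Longrightarrow> cinner V (S x) y = cinner V x (T y)"
  shows "adjoint_op V T = S"
  unfolding adjoint_op_def
proof (rule the_equality)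
  show "S \<in> lin_maps V V \<and> (\<forall>x\<in>carrier V. \<forall>y\<in>carrier V. cinner V (S x) y = cinner V x (T y))"
    using S adj by blast
next
  fix R
  assume R: "R \<in> lin_maps V V \<and>
    (\<forall>x\<in>carrier V. \<forall>y\<in>carrier V. cinner V (R x) y = cinner V x (T y))"
  show "R = S"
  proof (rule extensionalityI)
    show "R \<in> extensional (carrier V)" "S \<in> extensional (carrier V)"
      using R S by (auto simp: lin_maps_def)
    fix x assume x: "x \<in> carrier V"
    show "R x = S x"
      using R S x adj
      by (intro cinner_right_cancel) (auto simp: lin_maps_def LinearCombinations.module_hom_def)
  qed
qed

end

section \<open>Composition of linear and bilinear maps\<close>

lemma lin_maps_closed: "\<lbrakk>L \<in> lin_maps V W; x \<in> carrier V\<rbrakk> \<Longrightarrow> L x \<in> carrier W"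
  by (auto simp: lin_maps_def LinearCombinations.module_hom_def)

lemma lin_maps_compose:
  assumes "L \<in> lin_maps U V" "M \<in> lin_maps V W" "fd_hilbert U"
  shows "compose (carrier U) M L \<in> lin_maps U W"
proof -
  interpret U: fd_hilbert U by fact
  show ?thesis
    using assms(1,2) U.scale_closed
    by (auto simp: lin_maps_def LinearCombinations.module_hom_def compose_def Pi_iff)
qed

lemma lin_maps_id:
  assumes "fd_hilbert V"
  shows "(\<lambda>x\<in>carrier V. x) \<in> lin_maps V V"
proof -
  interpret fd_hilbert V by fact
  show ?thesis
    using scale_closed by (auto simp: lin_maps_def LinearCombinations.module_hom_def)
qed

text \<open>One form for two uses: a linear map applied after the tensor product, and a pair of
  operators applied before it, with identities in the remaining places.\<close>

lemma bilinear_map_comp: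
  assumes t: "bilinear_map U1 U2 W t"
    and L: "L \<in> LinearCombinations.module_hom (class_ring :: complex ring) W W'"
    and L1: "L1 \<in> LinearCombinations.module_hom (class_ring :: complex ring) V1 U1"
    and L2: "L2 \<in> LinearCombinations.module_hom (class_ring :: complex ring) V2 U2"
  shows "bilinear_map V1 V2 W' (\<lambda>x y. L (t (L1 x) (L2 y)))"
  using assms unfolding bilinear_map_def LinearCombinations.module_hom_def
  by (simp add: Pi_iff)

lemma module_hom_ident:
  "(\<lambda>x. x) \<in> LinearCombinations.module_hom (class_ring :: complex ring) V V"
  by (simp add: LinearCombinations.module_hom_def)

section \<open>One tensor product: metric and universal property\<close>

locale hilbert_tensor = H1: fd_hilbert H1 + H2: fd_hilbert H2 + H: fd_hilbert H
  for H1 :: "'a hilbert" and H2 :: "'b hilbert" and H :: "'c hilbert" +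
  fixes t :: "'a \<Rightarrow> 'b \<Rightarrow> 'c"
  assumes tensor: "tensor_product H1 H2 H t"
begin

lemma bilinear: "bilinear_map H1 H2 H t"
  using tensor by (simp add: tensor_product_def)

lemma left_hom:
  "y \<in> carrier H2 \<Longrightarrow>
    (\<lambda>x. t x y) \<in> LinearCombinations.module_hom (class_ring :: complex ring) H1 H"
  using bilinear by (simp add: bilinear_map_def)

lemma right_hom:
  "x \<in> carrier H1 \<Longrightarrow> t x \<in> LinearCombinations.module_hom (class_ring :: complex ring) H2 H"
  using bilinear by (simp add: bilinear_map_def)

lemma t_closed: "\<lbrakk>x \<in> carrier H1; y \<in> carrier H2\<rbrakk> \<Longrightarrow> t x y \<in> carrier H"
  using left_hom LinearCombinations.module_hom_closed by blast

lemma t_scale: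
  assumes "x \<in> carrier H1" "y \<in> carrier H2"
  shows "t (a \<odot>\<^bsub>H1\<^esub> x) (b \<odot>\<^bsub>H2\<^esub> y) = (a * b) \<odot>\<^bsub>H\<^esub> t x y"
  using LinearCombinations.module_hom_smult[OF left_hom, of "b \<odot>\<^bsub>H2\<^esub> y" a x]
    LinearCombinations.module_hom_smult[OF right_hom, of x b y]
    H.smult_assoc1[of a b "t x y"] assms H2.scale_closed t_closed
  by simp

text \<open>Nonzero vectors are rescaled to unit vectors, where norm preservation applies, and
  homogeneity undoes the scaling.\<close>

lemma hnorm_tensor:
  assumes x: "x \<in> carrier H1" and y: "y \<in> carrier H2"
  shows "hnorm H (t x y) = hnorm H1 x * hnorm H2 y"
proof (cases "x = \<zero>\<^bsub>H1\<^esub> \<or> y = \<zero>\<^bsub>H2\<^esub>")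
  case True
  \<comment> \<open>A zero vector equals 0 times itself, and bilinearity moves this scalar 0 out of
    the tensor.\<close>
  have "t x y = 0 \<odot>\<^bsub>H\<^esub> t x y"
    using True t_scale[OF x y, of 0 1] t_scale[OF x y, of 1 0] x y
      H1.lmult_0 H2.lmult_0 H1.smult_one H2.smult_one
    by auto
  then have "hnorm H (t x y) = 0"
    using H.hnorm_scale[OF t_closed[OF x y], of 0] by simp
  moreover have "hnorm H1 x * hnorm H2 y = 0"
    using True H1.cinner_zero_right[of x] H2.cinner_zero_right[of y] by (auto simp: hnorm_def)
  ultimately show ?thesis by simp
next
  case False
  define a b where "a = hnorm H1 x" and "b = hnorm H2 y"
  have pos: "0 < a" "0 < b"
    using False x y H1.hnorm_pos H2.hnorm_pos by (auto simp: a_def b_def)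
  let ?x = "of_real (inverse a) \<odot>\<^bsub>H1\<^esub> x" and ?y = "of_real (inverse b) \<odot>\<^bsub>H2\<^esub> y"
  have "hnorm H1 ?x = 1" "hnorm H2 ?y = 1"
    using pos x y
    by (simp_all add: H1.hnorm_scale H2.hnorm_scale norm_inverse flip: a_def b_def)
  then have "hnorm H (t ?x ?y) = 1"
    using tensor x y H1.scale_closed H2.scale_closed by (simp add: tensor_product_def)
  then have "inverse a * inverse b * hnorm H (t x y) = 1"
    using x y t_closed pos by (simp add: t_scale H.hnorm_scale norm_mult norm_inverse)
  then show ?thesis
    using pos by (simp add: field_simps flip: a_def b_def)
qed

text \<open>Two polarizations. With the same \<open>z\<close> in both second slots, the diagonal in
  \<open>x\<close> is known from \<open>hnorm_tensor\<close>. The result \<open>left\<close> is then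
  the diagonal for polarizing in \<open>y\<close> with \<open>x\<close> and \<open>x'\<close>
  fixed.\<close>

lemma cinner_tensor:
  assumes x: "x \<in> carrier H1" "x' \<in> carrier H1" and y: "y \<in> carrier H2" "y' \<in> carrier H2"
  shows "cinner H (t x y) (t x' y') = cinner H1 x x' * cinner H2 y y'"
proof -
  have left: "cinner H (t x z) (t x' z) = cinner H2 z z * cinner H1 x x'"
    if z: "z \<in> carrier H2" for z
    using H1.sesquilinear_polarization[OF H.sesquilinear_cinner_hom[OF left_hom[OF z] left_hom[OF z]]
        H1.sesquilinear_scaled_cinner[of "cinner H2 z z"]] x z t_closed
    by (simp add: H.cinner_self H1.cinner_self H2.cinner_self hnorm_tensor power_mult_distrib)
  show ?thesis
    using H2.sesquilinear_polarization[OF H.sesquilinear_cinner_hom[OF right_hom right_hom]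
        H2.sesquilinear_scaled_cinner[of "cinner H1 x x'"]] x y left
    by simp
qed

lemma ex1_induced:
  fixes V :: "'c hilbert"
  assumes "fd_hilbert V" "bilinear_map H1 H2 V \<beta>"
  shows "\<exists>!L. L \<in> lin_maps H V \<and> (\<forall>x\<in>carrier H1. \<forall>y\<in>carrier H2. \<beta> x y = L (t x y))"
  using tensor assms by (simp add: tensor_product_def)

text \<open>The uniqueness half of maximal generality, for the bilinear map obtained by applying
  \<open>L\<close> to tensors: both \<open>L\<close> and \<open>M\<close> induce it. It takes the
  place of an argument that pure tensors span \<open>H\<close>.\<close>

lemma lin_maps_eq_on_tensors:
  fixes V :: "'c hilbert"
  assumes V: "fd_hilbert V" and L: "L \<in> lin_maps H V" and M: "M \<in> lin_maps H V"
    and eq: "\<And>x y. \<lbrakk>x \<in> carrier H1; y \<in> carrier H2\<rbrakk> \<Longrightarrow> L (t x y) = M (t x y)"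
  shows "L = M"
proof -
  have "bilinear_map H1 H2 V (\<lambda>x y. L (t x y))"
    by (rule bilinear_map_comp[OF bilinear _ module_hom_ident module_hom_ident])
      (use L in \<open>simp add: lin_maps_def\<close>)
  then have "\<exists>!N. N \<in> lin_maps H V \<and> (\<forall>x\<in>carrier H1. \<forall>y\<in>carrier H2. L (t x y) = N (t x y))"
    by (rule ex1_induced[OF V])
  then show ?thesis
    using L M eq by blast
qed

text \<open>The universal property only covers targets on the element type of \<open>H\<close>, so a functional
  \<open>f\<close> is replaced by the rank-one operator \<open>v \<mapsto> f v \<odot> u\<close>.\<close>

lemma functional_eq_on_tensors:
  fixes f g :: "'c \<Rightarrow> complex"
  assumes f_add: "\<And>u v. \<lbrakk>u \<in> carrier H; v \<in> carrier H\<rbrakk> \<Longrightarrow> f (u \<oplus>\<^bsub>H\<^esub> v) = f u + f v"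
    and f_scale: "\<And>c u. u \<in> carrier H \<Longrightarrow> f (c \<odot>\<^bsub>H\<^esub> u) = c * f u"
    and g_add: "\<And>u v. \<lbrakk>u \<in> carrier H; v \<in> carrier H\<rbrakk> \<Longrightarrow> g (u \<oplus>\<^bsub>H\<^esub> v) = g u + g v"
    and g_scale: "\<And>c u. u \<in> carrier H \<Longrightarrow> g (c \<odot>\<^bsub>H\<^esub> u) = c * g u"
    and eq: "\<And>x y. \<lbrakk>x \<in> carrier H1; y \<in> carrier H2\<rbrakk> \<Longrightarrow> f (t x y) = g (t x y)"
    and u: "u \<in> carrier H"
  shows "f u = g u"
proof (cases "u = \<zero>\<^bsub>H\<^esub>")
  case True
  then show ?thesis
    using f_add[OF u u] g_add[OF u u] u by simp
next
  case False
  have rank_one: "(\<lambda>v\<in>carrier H. h v \<odot>\<^bsub>H\<^esub> u) \<in> lin_maps H H"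
    if "\<And>v w. \<lbrakk>v \<in> carrier H; w \<in> carrier H\<rbrakk> \<Longrightarrow> h (v \<oplus>\<^bsub>H\<^esub> w) = h v + h w"
      and "\<And>c v. v \<in> carrier H \<Longrightarrow> h (c \<odot>\<^bsub>H\<^esub> v) = c * h v" for h :: "'c \<Rightarrow> complex"
    using that u H.scale_closed H.smult_l_distr[of _ _ u] H.smult_assoc1[of _ _ u]
    by (auto simp: lin_maps_def LinearCombinations.module_hom_def)
  have eq_ops: "(\<lambda>v\<in>carrier H. f v \<odot>\<^bsub>H\<^esub> u) = (\<lambda>v\<in>carrier H. g v \<odot>\<^bsub>H\<^esub> u)"
    using rank_one[of f] rank_one[of g] assms t_closed H.fd_hilbert_axioms
    by (intro lin_maps_eq_on_tensors[of H]) auto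
  \<comment> \<open>The vector \<open>u\<close> spans the range of both operators and is also the
    test point; pairing with \<open>u\<close> then leaves a factor \<open>cinner H u u\<close>,
    which is nonzero in this case.\<close>
  have "f u \<odot>\<^bsub>H\<^esub> u = g u \<odot>\<^bsub>H\<^esub> u"
    using fun_cong[OF eq_ops, of u] u by simp
  then have "f u * cinner H u u = g u * cinner H u u"
    using H.cinner_smult_right[OF u u] by metis
  then show ?thesis
    using H.cinner_pos[OF u False] by auto
qed

lemma tensor_op_eqI:
  assumes T: "T \<in> lin_maps H H"
    and eq: "\<And>x y. \<lbrakk>x \<in> carrier H1; y \<in> carrier H2\<rbrakk> \<Longrightarrow> T (t x y) = t (L1 x) (L2 y)"
  shows "tensor_op H1 H2 H t L1 L2 = T"
  unfolding tensor_op_def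
proof (rule the_equality)
  show "T \<in> lin_maps H H \<and> (\<forall>x\<in>carrier H1. \<forall>y\<in>carrier H2. T (t x y) = t (L1 x) (L2 y))"
    using T eq by blast
next
  fix R
  assume "R \<in> lin_maps H H \<and> (\<forall>x\<in>carrier H1. \<forall>y\<in>carrier H2. R (t x y) = t (L1 x) (L2 y))"
  then show "R = T"
    by (intro lin_maps_eq_on_tensors[OF H.fd_hilbert_axioms _ T]) (simp_all add: eq)
qed

text \<open>Existence: the universal property is applied to the bilinear map sending
  \<open>x\<close>, \<open>y\<close> to \<open>t (L1 x) (L2 y)\<close>, and the induced operator is
  the described one.\<close>

lemma tensor_op:
  assumes L1: "L1 \<in> lin_maps H1 H1" and L2: "L2 \<in> lin_maps H2 H2"
  shows "tensor_op H1 H2 H t L1 L2 \<in> lin_maps H H"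
    and "\<And>x y. \<lbrakk>x \<in> carrier H1; y \<in> carrier H2\<rbrakk> \<Longrightarrow>
      tensor_op H1 H2 H t L1 L2 (t x y) = t (L1 x) (L2 y)"
proof -
  have "bilinear_map H1 H2 H (\<lambda>x y. t (L1 x) (L2 y))"
    by (rule bilinear_map_comp[OF bilinear module_hom_ident])
      (use L1 L2 in \<open>simp_all add: lin_maps_def\<close>)
  from ex1_induced[OF H.fd_hilbert_axioms this] obtain T where
    "T \<in> lin_maps H H" "\<forall>x\<in>carrier H1. \<forall>y\<in>carrier H2. t (L1 x) (L2 y) = T (t x y)"
    by blast
  moreover from this have "tensor_op H1 H2 H t L1 L2 = T"
    by (intro tensor_op_eqI) auto
  ultimately show "tensor_op H1 H2 H t L1 L2 \<in> lin_maps H H"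
    and "\<And>x y. \<lbrakk>x \<in> carrier H1; y \<in> carrier H2\<rbrakk> \<Longrightarrow>
      tensor_op H1 H2 H t L1 L2 (t x y) = t (L1 x) (L2 y)"
    by auto
qed

end

section \<open>The transition operator between two tensor products\<close>

locale hilbert_tensor_pair = a: hilbert_tensor H1 H2 H ta + b: hilbert_tensor H1 H2 H tb
  for H1 :: "'a hilbert" and H2 :: "'b hilbert" and H :: "'c hilbert" and ta tb
begin

text \<open>By \<open>cinner_tensor\<close>, inner products of pure tensors have the same value for
  \<open>ta\<close> and \<open>tb\<close>, so \<open>L\<close> preserves them; the identity is then
  extended from pure tensors to all vectors one slot at a time.\<close>

lemma transition_isometry:
  assumes L: "L \<in> lin_maps H H"
    and eq: "\<And>x y. \<lbrakk>x \<in> carrier H1; y \<in> carrier H2\<rbrakk> \<Longrightarrow> L (ta x y) = tb x y"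
    and uv: "u \<in> carrier H" "v \<in> carrier H"
  shows "cinner H (L u) (L v) = cinner H u v"
proof -
  note closed = lin_maps_closed[OF L]
  have L_add: "L (p \<oplus>\<^bsub>H\<^esub> q) = L p \<oplus>\<^bsub>H\<^esub> L q" if "p \<in> carrier H" "q \<in> carrier H" for p q
    using that L by (simp add: lin_maps_def LinearCombinations.module_hom_def)
  have L_scale: "L (c \<odot>\<^bsub>H\<^esub> p) = c \<odot>\<^bsub>H\<^esub> L p" if "p \<in> carrier H" for c p
    using that L by (simp add: lin_maps_def LinearCombinations.module_hom_def)
  \<comment> \<open>For fixed \<open>p\<close> both sides are linear functionals of
    \<open>q\<close>, so agreement on pure tensors suffices.\<close>
  have extend: "cinner H (L p) (L q) = cinner H p q"
    if p: "p \<in> carrier H" and q: "q \<in> carrier H"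
      and tens: "\<And>x y. \<lbrakk>x \<in> carrier H1; y \<in> carrier H2\<rbrakk> \<Longrightarrow>
        cinner H (L p) (L (ta x y)) = cinner H p (ta x y)" for p q
    by (rule a.functional_eq_on_tensors[where f = "\<lambda>q. cinner H (L p) (L q)"
          and g = "\<lambda>q. cinner H p q"])
      (use p q tens closed in \<open>auto simp: L_add L_scale a.H.cinner_add_right a.H.cinner_smult_right\<close>)
  have pure: "cinner H (L (ta x y)) (L q) = cinner H (ta x y) q"
    if "x \<in> carrier H1" "y \<in> carrier H2" "q \<in> carrier H" for x y q
    by (rule extend[OF a.t_closed])
      (use that in \<open>simp_all add: eq a.cinner_tensor b.cinner_tensor\<close>)
  show ?thesis
  proof (rule extend[OF uv])
    fix x y assume xy: "x \<in> carrier H1" "y \<in> carrier H2"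
    \<comment> \<open>Here the pure tensor sits in the right slot, while \<open>pure\<close> has it
      in the left one; conjugate symmetry exchanges them.\<close>
    show "cinner H (L u) (L (ta x y)) = cinner H u (ta x y)"
      using pure[OF xy uv(1)] a.t_closed[OF xy] uv(1) closed
      by (metis a.H.cinner_commute)
  qed
qed

text \<open>The maps \<open>W\<close> and \<open>S\<close> induced in the two directions are
  mutually inverse, because both composites fix pure tensors, and the isometry property makes
  \<open>S\<close> the adjoint of \<open>W\<close>. The action of the adjoint on
  \<open>tb x y\<close> is recorded for the conjugation formula.\<close>

lemma transition_unitary:
  obtains W where "unitary_op H W" "adjoint_op H W \<in> lin_maps H H"
    "\<And>x y. \<lbrakk>x \<in> carrier H1; y \<in> carrier H2\<rbrakk> \<Longrightarrow> W (ta x y) = tb x y"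
    "\<And>x y. \<lbrakk>x \<in> carrier H1; y \<in> carrier H2\<rbrakk> \<Longrightarrow> adjoint_op H W (tb x y) = ta x y"
proof -
  have fd: "fd_hilbert H" by (rule a.H.fd_hilbert_axioms)
  obtain W where W: "W \<in> lin_maps H H"
    and Wt: "\<And>x y. \<lbrakk>x \<in> carrier H1; y \<in> carrier H2\<rbrakk> \<Longrightarrow> W (ta x y) = tb x y"
    using a.ex1_induced[OF fd b.bilinear] by metis
  obtain S where S: "S \<in> lin_maps H H"
    and St: "\<And>x y. \<lbrakk>x \<in> carrier H1; y \<in> carrier H2\<rbrakk> \<Longrightarrow> S (tb x y) = ta x y"
    using b.ex1_induced[OF fd a.bilinear] by metis
  have SW: "compose (carrier H) S W = (\<lambda>x\<in>carrier H. x)"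
    using W S Wt St a.t_closed b.t_closed fd
    by (intro a.lin_maps_eq_on_tensors[OF fd] lin_maps_compose lin_maps_id) (auto simp: compose_eq)
  have WS: "compose (carrier H) W S = (\<lambda>x\<in>carrier H. x)"
    using W S Wt St a.t_closed b.t_closed fd
    by (intro b.lin_maps_eq_on_tensors[OF fd] lin_maps_compose lin_maps_id) (auto simp: compose_eq)
  \<comment> \<open>Since \<open>W\<close> is isometric and \<open>W (S x) = x\<close>, one has <S
    x, y> = <W (S x), W y> = <x, W y>.\<close>
  have "adjoint_op H W = S"
  proof (rule a.H.adjoint_op_eqI[OF S])
    fix x y assume xy: "x \<in> carrier H" "y \<in> carrier H"
    have "W (S x) = x"
      using fun_cong[OF WS, of x] xy by (simp add: compose_eq)
    then show "cinner H (S x) y = cinner H x (W y)"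
      using transition_isometry[OF W Wt lin_maps_closed[OF S xy(1)] xy(2)] by simp
  qed
  then show ?thesis
    using W S Wt St SW WS by (intro that[of W]) (auto simp: unitary_op_def)
qed

text \<open>Linearity is used in one slot at a time: first \<open>x\<close> varies with
  \<open>f\<close> in \<open>B2\<close> fixed, then \<open>y\<close> varies with an arbitrary
  \<open>x\<close> fixed.\<close>

lemma eq_on_bases:
  assumes L: "L \<in> lin_maps H H"
    and B1: "a.H1.basis B1" and B2: "a.H2.basis B2"
    and eq: "\<And>e f. \<lbrakk>e \<in> B1; f \<in> B2\<rbrakk> \<Longrightarrow> L (ta e f) = tb e f"
    and xy: "x \<in> carrier H1" "y \<in> carrier H2"
  shows "L (ta x y) = tb x y"
proof -
  have bil: "bilinear_map H1 H2 H (\<lambda>x y. L (ta x y))"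
    by (rule bilinear_map_comp[OF a.bilinear _ module_hom_ident module_hom_ident])
      (use L in \<open>simp add: lin_maps_def\<close>)
  have "B2 \<subseteq> carrier H2"
    using B2 by (simp add: a.H2.basis_def)
  then have "L (ta x f) = tb x f" if "f \<in> B2" for f
    using a.H1.module_hom_eq_on_basis[OF a.H.fd_hilbert_axioms B1, of "\<lambda>x. L (ta x f)" "\<lambda>x. tb x f" x]
      that bil b.left_hom eq xy(1) by (auto simp: bilinear_map_def)
  then show ?thesis
    using a.H2.module_hom_eq_on_basis[OF a.H.fd_hilbert_axioms B2, of "\<lambda>y. L (ta x y)" "tb x" y]
      bil b.right_hom xy by (auto simp: bilinear_map_def)
qed

end

theorem lemma3p1:
  fixes H1 :: "'a hilbert" and H2 :: "'b hilbert" and H :: "'c hilbert"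
    and ta tb :: "'a \<Rightarrow> 'b \<Rightarrow> 'c"
    and B1 :: "'a set" and B2 :: "'b set"
  assumes "fd_hilbert H1" and "fd_hilbert H2" and "fd_hilbert H"
    and "tensor_product H1 H2 H ta" and "tensor_product H1 H2 H tb"
    and "orthonormal_basis H1 B1" and "orthonormal_basis H2 B2"
  shows
    "(\<exists>!W. unitary_op H W \<and> (\<forall>x\<in>carrier H1. \<forall>y\<in>carrier H2. tb x y = W (ta x y))) \<and>
     (\<forall>W. unitary_op H W \<and> (\<forall>x\<in>carrier H1. \<forall>y\<in>carrier H2. tb x y = W (ta x y)) \<longrightarrow>
        (\<forall>U. unitary_op H U \<longrightarrow>
           ((\<forall>e\<in>B1. \<forall>f\<in>B2. U (ta e f) = tb e f) \<longleftrightarrow> U = W)) \<and>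
        (\<forall>L1\<in>lin_maps H1 H1. \<forall>L2\<in>lin_maps H2 H2.
           tensor_op H1 H2 H tb L1 L2 =
             compose (carrier H) W
               (compose (carrier H) (tensor_op H1 H2 H ta L1 L2) (adjoint_op H W))))"
proof -
  interpret hilbert_tensor_pair H1 H2 H ta tb
    using assms by (simp add: hilbert_tensor_pair_def hilbert_tensor_def hilbert_tensor_axioms_def)
  let ?P = "\<lambda>W. unitary_op H W \<and> (\<forall>x\<in>carrier H1. \<forall>y\<in>carrier H2. tb x y = W (ta x y))"
  have basis: "a.H1.basis B1" "a.H2.basis B2"
    using assms(6,7) by (simp_all add: orthonormal_basis_def)
  then have sub: "B1 \<subseteq> carrier H1" "B2 \<subseteq> carrier H2"
    by (simp_all add: a.H1.basis_def a.H2.basis_def)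
  obtain W where W: "unitary_op H W" and adj: "adjoint_op H W \<in> lin_maps H H"
    and Wt: "\<And>x y. \<lbrakk>x \<in> carrier H1; y \<in> carrier H2\<rbrakk> \<Longrightarrow> W (ta x y) = tb x y"
    and At: "\<And>x y. \<lbrakk>x \<in> carrier H1; y \<in> carrier H2\<rbrakk> \<Longrightarrow> adjoint_op H W (tb x y) = ta x y"
    using transition_unitary by blast
  have lin: "U \<in> lin_maps H H" if "unitary_op H U" for U
    using that by (simp add: unitary_op_def)
  have unique: "U = W" if "unitary_op H U"
    "\<And>x y. \<lbrakk>x \<in> carrier H1; y \<in> carrier H2\<rbrakk> \<Longrightarrow> U (ta x y) = tb x y" for U
    using that Wt a.lin_maps_eq_on_tensors[OF assms(3) lin lin[OF W]] by simp
  \<comment> \<open>Existence and uniqueness packed into one equivalence: rewriting with it reduces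
    the first claim to \<open>U = W\<close> having exactly one solution, and the later claims to
    this \<open>W\<close>.\<close>
  have P: "?P U \<longleftrightarrow> U = W" for U
    using unique[of U] W Wt by auto
  have bases: "(\<forall>e\<in>B1. \<forall>f\<in>B2. U (ta e f) = tb e f) \<longleftrightarrow> U = W" if U: "unitary_op H U" for U
  proof
    assume "\<forall>e\<in>B1. \<forall>f\<in>B2. U (ta e f) = tb e f"
    then show "U = W"
      using eq_on_bases[OF lin[OF U] basis] U by (intro unique) auto
  qed (use sub Wt in blast)
  have conj: "tensor_op H1 H2 H tb L1 L2 = compose (carrier H) W
      (compose (carrier H) (tensor_op H1 H2 H ta L1 L2) (adjoint_op H W))"
    if L: "L1 \<in> lin_maps H1 H1" "L2 \<in> lin_maps H2 H2" for L1 L2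
  \<comment> \<open>It suffices to evaluate on \<open>tb x y\<close>: the adjoint carries it back to
    \<open>ta x y\<close>, the operator in the middle yields \<open>ta (L1 x) (L2 y)\<close>, and
    \<open>W\<close> sends this to \<open>tb (L1 x) (L2 y)\<close>.\<close>
  proof (rule b.tensor_op_eqI)
    show "compose (carrier H) W (compose (carrier H) (tensor_op H1 H2 H ta L1 L2) (adjoint_op H W))
        \<in> lin_maps H H"
      using a.tensor_op(1)[OF L] adj lin[OF W] assms(3) by (intro lin_maps_compose)
  next
    fix x y assume xy: "x \<in> carrier H1" "y \<in> carrier H2"
    then show "compose (carrier H) W
        (compose (carrier H) (tensor_op H1 H2 H ta L1 L2) (adjoint_op H W)) (tb x y) = tb (L1 x) (L2 y)"
      using a.tensor_op(2)[OF L xy] lin_maps_closed[OF L(1)] lin_maps_closed[OF L(2)] b.t_closed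
      by (simp add: compose_eq At Wt)
  qed
  show ?thesis
    unfolding P using bases conj by blast
qed

end
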